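(* Let $0<q<1$, let $m\ge0$ be an integer and let $0\le\alpha<1$. Let $f\in\overline{\mathcal{H}}_q^m(\alpha)$, written as $f=h+\overline{g}$ with $h(z)=z-\sum_{n=2}^{\infty}a_nz^n$, $g(z)=(-1)^m\sum_{n=1}^{\infty}b_nz^n$, $a_n\ge0$, $b_n\ge0$. Then for $|z|=r<1$, $$(1-b_1)r-\frac{1}{[2]_q^m}\left(\frac{1-\alpha}{[2]_q-\alpha}-\frac{1+\alpha}{[2]_q-\alpha}b_1\right)r^2\le|f(z)|\le(1+b_1)r+\frac{1}{[2]_q^m}\left(\frac{1-\alpha}{[2]_q-\alpha}-\frac{1+\alpha}{[2]_q-\alpha}b_1\right)r^2 .$$
   Context: $\mathbb{D}=\{z\in\mathbb{C}:|z|<1\}$. For $0<q<1$ and a positive integer $n$, $[n]_q=\frac{1-q^n}{1-q}=\sum_{k=0}^{n-1}q^k$ (so $[2]_q=1+q$), and $[n]_q^m=([n]_q)^m$. For a function $\phi(z)=\sum_{n\ge1}c_nz^n$ analytic in $\mathbb{D}$, the Salagean $q$-differential operator is defined by $\mathcal{D}_q^0\phi=\phi$, $\mathcal{D}_q^1\phi(z)=\frac{\phi(z)-\phi(qz)}{1-q}$ and $\mathcal{D}_q^m\phi=\mathcal{D}_q^1(\mathcal{D}_q^{m-1}\phi)$; equivalently $\mathcal{D}_q^m\phi(z)=\sum_{n\ge1}[n]_q^mc_nz^n$. For a harmonic function $f=h+\overline{g}$ in $\mathbb{D}$, with $h(z)=z+\sum_{n\ge2}a_nz^n$ and $g(z)=\sum_{n\ge1}b_nz^n$,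 $|b_1|<1$, analytic in $\mathbb{D}$, put $\mathcal{D}_q^mf(z)=\mathcal{D}_q^mh(z)+(-1)^m\overline{\mathcal{D}_q^mg(z)}$. $\mathcal{H}_q^m(\alpha)$ is the family of harmonic functions $f=h+\overline{g}$ of this form such that $\Re\left(\frac{\mathcal{D}_q^{m+1}f(z)}{\mathcal{D}_q^mf(z)}\right)\ge\alpha$ for all $z\in\mathbb{D}\setminus\{0\}$. $\overline{\mathcal{H}}_q^m(\alpha)$ is the subclass of $\mathcal{H}_q^m(\alpha)$ consisting of those $f=h+\overline{g}$ for which $h(z)=z-\sum_{n=2}^{\infty}a_nz^n$ and $g(z)=(-1)^m\sum_{n=1}^{\infty}b_nz^n$ with all $a_n\ge0$, $b_n\ge0$. *)

theory Defs
  imports "HOL-Complex_Analysis.Complex_Analysis"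
begin

definition qint :: "real \<Rightarrow> nat \<Rightarrow> real" where
  "qint q n = (1 - q ^ n) / (1 - q)"

primrec salagean_q :: "real \<Rightarrow> nat \<Rightarrow> (complex \<Rightarrow> complex) \<Rightarrow> complex \<Rightarrow> complex" where
  "salagean_q q 0 \<phi> = \<phi>"
| "salagean_q q (Suc m) \<phi> =
     (\<lambda>z. (salagean_q q m \<phi> z - salagean_q q m \<phi> (of_real q * z)) / (1 - of_real q))"

text \<open>
  Applied to \<open>f = h + cnj g\<close>, the operator acts on the pair \<open>(h, g)\<close>. The normalisation
  \<open>g 0 = 0\<close> built into the next definition makes this pair unique on the unit disc.
\<close>

definition salagean_q_harmonic ::
  "real \<Rightarrow> nat \<Rightarrow> (complex \<Rightarrow> complex) \<Rightarrow> (complex \<Rightarrow> complex) \<Rightarrow> complex \<Rightarrow> complex" where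
  "salagean_q_harmonic q m h g z = salagean_q q m h z + (-1) ^ m * cnj (salagean_q q m g z)"

definition harmonic_decomp ::
  "(complex \<Rightarrow> complex) \<Rightarrow> (complex \<Rightarrow> complex) \<Rightarrow> (complex \<Rightarrow> complex) \<Rightarrow> bool" where
  "harmonic_decomp f h g \<longleftrightarrow>
     h holomorphic_on ball 0 1 \<and> g holomorphic_on ball 0 1 \<and>
     (\<forall>z\<in>ball 0 1. f z = h z + cnj (g z)) \<and>
     (\<exists>a b :: nat \<Rightarrow> complex.
        (\<forall>z\<in>ball 0 1. (\<lambda>n. a (n + 2) * z ^ (n + 2)) sums (h z - z)) \<and>
        (\<forall>z\<in>ball 0 1. (\<lambda>n. b (n + 1) * z ^ (n + 1)) sums g z) \<and>
        norm (b 1) < 1)"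

text \<open>
  The condition on the quotient includes that the quotient is defined, since division by zero
  yields \<open>0\<close> here. Values of \<open>f\<close> outside the unit disc are irrelevant.
\<close>

definition harmonic_class :: "real \<Rightarrow> nat \<Rightarrow> real \<Rightarrow> (complex \<Rightarrow> complex) set" where
  "harmonic_class q m \<alpha> =
     {f. \<exists>h g. harmonic_decomp f h g \<and>
        (\<forall>z\<in>ball 0 1 - {0}.
           salagean_q_harmonic q m h g z \<noteq> 0 \<and>
           Re (salagean_q_harmonic q (m + 1) h g z / salagean_q_harmonic q m h g z) \<ge> \<alpha>)}"

text \<open>Only \<open>a n\<close> for \<open>n \<ge> 2\<close> and \<open>b n\<close> for \<open>n \<ge> 1\<close> are coefficients; other values are unused.\<close>

definition negative_coeff_form ::
  "nat \<Rightarrow> (complex \<Rightarrow> complex) \<Rightarrow> (complex \<Rightarrow> complex) \<Rightarrow> (complex \<Rightarrow> complex)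
     \<Rightarrow> (nat \<Rightarrow> real) \<Rightarrow> (nat \<Rightarrow> real) \<Rightarrow> bool" where
  "negative_coeff_form m f h g a b \<longleftrightarrow>
     (\<forall>z\<in>ball 0 1. f z = h z + cnj (g z)) \<and>
     (\<forall>z\<in>ball 0 1. summable (\<lambda>n. of_real (a (n + 2)) * z ^ (n + 2)) \<and>
        h z = z - (\<Sum>n. of_real (a (n + 2)) * z ^ (n + 2))) \<and>
     (\<forall>z\<in>ball 0 1. summable (\<lambda>n. of_real (b (n + 1)) * z ^ (n + 1)) \<and>
        g z = (-1) ^ m * (\<Sum>n. of_real (b (n + 1)) * z ^ (n + 1))) \<and>
     (\<forall>n\<ge>2. a n \<ge> 0) \<and> (\<forall>n\<ge>1. b n \<ge> 0)"

definition neg_harmonic_class :: "real \<Rightarrow> nat \<Rightarrow> real \<Rightarrow> (complex \<Rightarrow> complex) set" where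
  "neg_harmonic_class q m \<alpha> =
     {f \<in> harmonic_class q m \<alpha>. \<exists>h g a b. negative_coeff_form m f h g a b}"

end

theory Submission
  imports Defs
begin

text \<open>
  On the segment \<open>(0, 1)\<close> both \<open>D\<^sup>m f\<close> and \<open>D\<^sup>m\<^sup>+\<^sup>1 f\<close> are real. The former does not vanish there
  and behaves like \<open>(1 + b\<^sub>1) x\<close> near \<open>0\<close>, so it is positive, and the condition on the quotient
  becomes a linear inequality between power series. Letting \<open>x\<close> tend to \<open>1\<close> gives
  \<open>(\<Sum>n\<ge>2. [n]\<^sup>m (([n] - \<alpha>) a\<^sub>n + ([n] + \<alpha>) b\<^sub>n)) \<le> 1 - \<alpha> - (1 + \<alpha>) b\<^sub>1\<close>, hence a bound on
  \<open>\<Sum>n\<ge>2. a\<^sub>n + b\<^sub>n\<close>, and the triangle inequality finishes the proof.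
\<close>

section \<open>Uniqueness of the analytic and co-analytic parts of a harmonic function\<close>

lemma holomorphic_on_real_valued_imp_constant_on:
  assumes holo: "f holomorphic_on S" and S: "open S" "connected S"
    and real: "\<And>z. z \<in> S \<Longrightarrow> f z \<in> \<real>"
  shows "f constant_on S"
proof (rule ccontr)
  assume nc: "\<not> f constant_on S"
  then obtain z where z: "z \<in> S"
    by (auto simp: constant_on_def)
  have "open (f ` S)"
    using open_mapping_thm[OF holo S S(1) order_refl nc] .
  then obtain e where e: "e > 0" "ball (f z) e \<subseteq> f ` S"
    using z by (meson imageI openE)
  \<comment> \<open>The image of a nonconstant map is open, so it would contain this point, which
    lies off the real line because \<open>f z\<close> is real.\<close>
  have "f z + \<i> * of_real (e / 2) \<in> ball (f z) e"
    using e(1) by (simp add: dist_norm norm_mult)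
  then obtain w where w: "w \<in> S" "f w = f z + \<i> * of_real (e / 2)"
    using e(2) by (metis (no_types, lifting) imageE subsetD)
  have "Im (f w) = 0" "Im (f z) = 0"
    using real[OF w(1)] real[OF z] by (auto simp: complex_is_Real_iff)
  then show False
    using w(2) e(1) by simp
qed

text \<open>Put \<open>u = h - h'\<close> and \<open>v = g' - g\<close>, so that
  \<open>u = cnj v\<close>. Then \<open>u + v\<close> and \<open>\<i> * (u - v)\<close> are
  holomorphic and real-valued, hence constant, and both vanish at \<open>w\<close>.\<close>

lemma harmonic_pair_unique:
  assumes holo: "h holomorphic_on S" "g holomorphic_on S" "h' holomorphic_on S" "g' holomorphic_on S"
    and S: "open S" "connected S"
    and eq: "\<And>z. z \<in> S \<Longrightarrow> h z + cnj (g z) = h' z + cnj (g' z)"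
    and w: "w \<in> S" "g w = g' w" and z: "z \<in> S"
  shows "h z = h' z" and "g z = g' z"
proof -
  have diff: "h z - h' z = cnj (g' z - g z)" if "z \<in> S" for z
    using eq[OF that] by (simp add: algebra_simps)
  have *: "(\<lambda>z. (h z - h' z) + (g' z - g z)) constant_on S"
  proof (rule holomorphic_on_real_valued_imp_constant_on)
    show "(h z - h' z) + (g' z - g z) \<in> \<real>" if "z \<in> S" for z
      unfolding diff[OF that] by (simp add: complex_is_Real_iff)
  qed (use holo S in \<open>auto intro!: holomorphic_intros\<close>)
  have **: "(\<lambda>z. \<i> * ((h z - h' z) - (g' z - g z))) constant_on S"
  proof (rule holomorphic_on_real_valued_imp_constant_on)
    show "\<i> * ((h z - h' z) - (g' z - g z)) \<in> \<real>" if "z \<in> S" for z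
      unfolding diff[OF that] by (simp add: complex_is_Real_iff)
  qed (use holo S in \<open>auto intro!: holomorphic_intros\<close>)
  have "(h z - h' z) + (g' z - g z) = (h w - h' w) + (g' w - g w)"
    using * w(1) z unfolding constant_on_def by metis
  moreover have "\<i> * ((h z - h' z) - (g' z - g z)) = \<i> * ((h w - h' w) - (g' w - g w))"
    using ** w(1) z unfolding constant_on_def by metis
  ultimately have "(h z - h' z) + (g' z - g z) = 0" "(h z - h' z) - (g' z - g z) = 0"
    using diff[OF w(1)] w(2) by simp_all
  then show "h z = h' z" "g z = g' z"
    by (auto simp: complex_eq_iff)
qed

section \<open>q-integers and the action of the operator on power series\<close>

lemma qint_1: "q \<noteq> 1 \<Longrightarrow> qint q (Suc 0) = 1"
  by (simp add: qint_def)

lemma qint_2: "q \<noteq> 1 \<Longrightarrow> qint q 2 = 1 + q"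
  by (simp add: qint_def divide_simps) (simp add: power2_eq_square algebra_simps)

lemma qint_mono:
  assumes "0 \<le> q" "q < 1" "k \<le> n"
  shows "qint q k \<le> qint q n"
  unfolding qint_def using assms power_decreasing[of k n q] by (intro divide_right_mono) auto

text \<open>One application of the operator multiplies the coefficient of \<open>z ^ n\<close> by
  \<open>(1 - q ^ n) / (1 - q)\<close>. The disc is stable under scaling by \<open>q\<close>, so the
  induction hypothesis applies at both \<open>z\<close> and \<open>q * z\<close>.\<close>

lemma salagean_q_sums:
  assumes q: "0 < q" "q < 1"
    and sums: "\<And>z. z \<in> ball 0 1 \<Longrightarrow> (\<lambda>n. c n * z ^ n) sums \<phi> z"
    and z: "z \<in> ball 0 1"
  shows "(\<lambda>n. of_real (qint q n ^ m) * c n * z ^ n) sums salagean_q q m \<phi> z"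
  using z
proof (induction m arbitrary: z)
  case 0
  then show ?case using sums by simp
next
  case (Suc m)
  have "norm (of_real q * z) \<le> 1 * norm z"
    unfolding norm_mult using q by (intro mult_right_mono) auto
  then have "of_real q * z \<in> ball 0 1"
    using Suc.prems by simp
  from sums_divide[OF sums_diff[OF Suc.IH[OF Suc.prems] Suc.IH[OF this]], of "1 - of_real q"]
  have "(\<lambda>n. (of_real (qint q n ^ m) * c n * z ^ n
      - of_real (qint q n ^ m) * c n * (of_real q * z) ^ n) / (1 - of_real q))
        sums salagean_q q (Suc m) \<phi> z"
    by simp
  moreover have "(of_real (qint q n ^ m) * c n * z ^ n
      - of_real (qint q n ^ m) * c n * (of_real q * z) ^ n) / (1 - of_real q)
        = of_real (qint q n ^ Suc m) * c n * z ^ n" for n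
    using q by (simp add: qint_def power_mult_distrib field_simps)
  ultimately show ?case by simp
qed

section \<open>Power series with real coefficients on the interval (0, 1)\<close>

lemma sums_of_real_coeffs:
  fixes x :: real and s :: complex
  assumes "(\<lambda>n. of_real (c n) * of_real x ^ n) sums s"
  shows "(\<lambda>n. c n * x ^ n) sums Re s" and "s = of_real (Re s)"
proof -
  show *: "(\<lambda>n. c n * x ^ n) sums Re s"
    using sums_Re[OF assms] by (simp flip: of_real_power of_real_mult)
  have "(\<lambda>n. of_real (c n) * of_real x ^ n) sums (of_real (Re s) :: complex)"
    using sums_of_real[OF *, where ?'a = complex] by simp
  then show "s = of_real (Re s)"
    using assms sums_unique2 by blast
qed

text \<open>Dividing by \<open>x\<close> gives a continuous function \<open>G\<close> with
  \<open>G 0 = c 1 > 0\<close>. A nonpositive value of \<open>F\<close> would force a zero of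
  \<open>G\<close> by the intermediate value theorem, hence a zero of \<open>F\<close>.\<close>

lemma powser_pos_if_nonzero:
  fixes c :: "nat \<Rightarrow> real"
  assumes sums: "\<And>x. 0 < x \<Longrightarrow> x < 1 \<Longrightarrow> (\<lambda>n. c n * x ^ n) sums F x"
    and nz: "\<And>x. 0 < x \<Longrightarrow> x < 1 \<Longrightarrow> F x \<noteq> 0"
    and c: "c 0 = 0" "c 1 > 0"
    and x: "0 < x" "x < 1"
  shows "F x > 0"
proof (rule ccontr)
  assume "\<not> F x > 0"
  define G where "G x = (\<Sum>n. c (Suc n) * x ^ n)" for x
  have G: "(\<lambda>n. c (Suc n) * y ^ n) sums (F y / y)" if "0 < y" "y < 1" for y
  proof -
    have "(\<lambda>n. c (Suc n) * y ^ Suc n) sums F y"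
      using sums[OF that] c by (subst sums_Suc_iff) simp
    from sums_divide[OF this, of y] show ?thesis
      using that by simp
  qed
  then have GF: "G y = F y / y" if "0 < y" "y < 1" for y
    using that sums_unique unfolding G_def by metis
  \<comment> \<open>Convergence at a point \<open>K\<close> beyond \<open>x\<close> makes the power
    series continuous on all of \<open>{0..x}\<close>.\<close>
  obtain K where K: "x < K" "K < 1"
    using x(2) dense by blast
  have "continuous_on {0..x} G"
    unfolding G_def
  proof (intro continuous_at_imp_continuous_on ballI)
    fix y assume y: "y \<in> {0..x}"
    have "summable (\<lambda>n. c (Suc n) * K ^ n)"
      using G[of K] K x by (auto simp: sums_iff)
    then show "isCont (\<lambda>x. \<Sum>n. c (Suc n) * x ^ n) y"
      by (rule isCont_powser) (use y K x in auto)
  qed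
  moreover have "G x \<le> 0"
    using GF[OF x] \<open>\<not> F x > 0\<close> x by (simp add: divide_nonpos_pos)
  moreover have G0: "G 0 > 0"
    using c(2) by (simp add: G_def)
  ultimately obtain y where y: "0 \<le> y" "y \<le> x" "G y = 0"
    using IVT2'[of G x 0 0] x by auto
  then have "y > 0"
    using G0 by (cases "y = 0") auto
  then show False
    using GF[of y] nz[of y] y x by auto
qed

text \<open>For nonnegative terms a partial sum is at most the whole series, hence at most
  \<open>B * x\<close>. Letting \<open>x\<close> tend to 1 in the finite sum avoids exchanging a
  limit with an infinite sum.\<close>

lemma sum_coeffs_le_of_powser_le:
  fixes t :: "nat \<Rightarrow> real"
  assumes "\<And>x. 0 < x \<Longrightarrow> x < 1 \<Longrightarrow> summable (\<lambda>n. t n * x ^ n)"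
    and bound: "\<And>x. 0 < x \<Longrightarrow> x < 1 \<Longrightarrow> (\<Sum>n. t n * x ^ n) \<le> B * x"
    and nonneg: "\<And>n. 0 \<le> t n"
  shows "sum t {..<N} \<le> B"
proof -
  have "((\<lambda>x. \<Sum>n<N. t n * x ^ n) \<longlongrightarrow> (\<Sum>n<N. t n * 1 ^ n)) (at_left 1)"
    by (intro tendsto_intros)
  moreover have "((\<lambda>x. B * x) \<longlongrightarrow> B * 1) (at_left 1)"
    by (intro tendsto_intros)
  moreover have "eventually (\<lambda>x. x \<in> {0<..<1}) (at_left (1::real))"
    by (rule eventually_at_leftI) auto
  then have "eventually (\<lambda>x. (\<Sum>n<N. t n * x ^ n) \<le> B * x) (at_left 1)"
  proof eventually_elim
    case (elim x)
    then have "(\<Sum>n<N. t n * x ^ n) \<le> (\<Sum>n. t n * x ^ n)"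
      using assms by (intro sum_le_suminf) auto
    then show ?case
      using bound[of x] elim by auto
  qed
  ultimately show ?thesis
    using tendsto_le[of "at_left (1::real)"] by fastforce
qed

section \<open>The coefficient inequality\<close>

lemma negative_coeff_form_sums:
  assumes "negative_coeff_form m f h g a b" and z: "z \<in> ball 0 1"
  shows "(\<lambda>n. of_real (if n = 0 then 0 else if n = 1 then 1 else - a n) * z ^ n) sums h z"
    and "(\<lambda>n. of_real ((-1) ^ m * (if n = 0 then 0 else b n)) * z ^ n) sums g z"
proof -
  \<comment> \<open>These are the tails beyond degree 1 for \<open>h\<close> and from degree 1 on
    for \<open>g\<close>; the factor \<open>(-1) ^ m\<close> is its own inverse. Shifting the index
    then restores the initial terms.\<close>
  have h: "(\<lambda>n. of_real (a (n + 2)) * z ^ (n + 2)) sums (z - h z)"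
    and g: "(\<lambda>n. of_real (b (n + 1)) * z ^ (n + 1)) sums ((-1) ^ m * g z)"
    using assms unfolding negative_coeff_form_def
    by (auto simp: sums_iff simp flip: mult.assoc power_mult_distrib)
  show "(\<lambda>n. of_real (if n = 0 then 0 else if n = 1 then 1 else - a n) * z ^ n) sums h z"
    by (subst sums_iff_shift'[of _ 2, symmetric])
      (use sums_minus[OF h] in \<open>simp add: numeral_2_eq_2\<close>)
  show "(\<lambda>n. of_real ((-1) ^ m * (if n = 0 then 0 else b n)) * z ^ n) sums g z"
    by (subst sums_iff_shift'[of _ 1, symmetric])
      (use sums_mult[OF g, of "(-1) ^ m"] in \<open>simp flip: mult.assoc power_mult_distrib\<close>)
qed

text \<open>The bound is on partial sums because it is what later yields summability of the
  coefficients.\<close>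

lemma neg_harmonic_class_coeff_bound:
  assumes q: "0 < q" "q < 1" and \<alpha>: "0 \<le> \<alpha>" "\<alpha> < 1"
    and f: "f \<in> neg_harmonic_class q m \<alpha>"
    and neg: "negative_coeff_form m f h g a b"
  shows "(\<Sum>n<N. qint q (n + 2) ^ m *
      ((qint q (n + 2) - \<alpha>) * a (n + 2) + (qint q (n + 2) + \<alpha>) * b (n + 2)))
        \<le> 1 - \<alpha> - (1 + \<alpha>) * b 1"
proof -
  define A where "A n = (if n = 0 then 0 else if n = 1 then 1 else - a n)" for n
  define B where "B n = (if n = 0 then 0 else b n)" for n
  have h: "(\<lambda>n. of_real (A n) * z ^ n) sums h z"
    and g: "(\<lambda>n. of_real ((-1) ^ m * B n) * z ^ n) sums g z" if "z \<in> ball 0 1" for z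
    using negative_coeff_form_sums[OF neg that] unfolding A_def B_def .
  have ab: "a n \<ge> 0" if "n \<ge> 2" for n using neg that by (simp add: negative_coeff_form_def)
  have bb: "b n \<ge> 0" if "n \<ge> 1" for n using neg that by (simp add: negative_coeff_form_def)
  \<comment> \<open>The pair witnessing membership in the class may a priori differ from
    \<open>h\<close>, \<open>g\<close>. Since \<open>g\<close> and \<open>g'\<close> both vanish at
    0, uniqueness identifies the two pairs on the disc.\<close>
  obtain h' g' where hg': "harmonic_decomp f h' g'"
    and quot: "\<And>z. z \<in> ball 0 1 - {0} \<Longrightarrow> salagean_q_harmonic q m h' g' z \<noteq> 0 \<and>
      Re (salagean_q_harmonic q (m + 1) h' g' z / salagean_q_harmonic q m h' g' z) \<ge> \<alpha>"
    using f unfolding neg_harmonic_class_def harmonic_class_def by blast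
  have holo: "h holomorphic_on ball 0 1" "g holomorphic_on ball 0 1"
    using power_series_holomorphic[of 0 1 "\<lambda>n. of_real (A n)" h]
      power_series_holomorphic[of 0 1 "\<lambda>n. of_real ((-1) ^ m * B n)" g] h g by simp_all
  have "g 0 = 0"
    using sums_unique2[OF g[of 0] powser_sums_zero] by (simp add: B_def)
  moreover have "g' 0 = 0"
  proof -
    obtain d where "\<forall>z\<in>ball 0 1. (\<lambda>n. d (n + 1) * z ^ (n + 1)) sums g' z"
      using hg' unfolding harmonic_decomp_def by blast
    from bspec[OF this, of 0] have "(\<lambda>n. 0) sums g' 0"
      by simp
    then show ?thesis
      using sums_unique2[OF sums_zero] by metis
  qed
  moreover have "h z + cnj (g z) = h' z + cnj (g' z)" if "z \<in> ball 0 1" for z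
    using that neg hg' unfolding harmonic_decomp_def negative_coeff_form_def by metis
  ultimately have eq: "h z = h' z" "g z = g' z" if "z \<in> ball 0 1" for z
    using harmonic_pair_unique[of h "ball 0 1" g h' g' 0 z] holo hg' that
    unfolding harmonic_decomp_def by auto
  have h': "(\<lambda>n. of_real (A n) * z ^ n) sums h' z"
    and g': "(\<lambda>n. of_real ((-1) ^ m * B n) * z ^ n) sums g' z" if "z \<in> ball 0 1" for z
    using h[OF that] g[OF that] eq[OF that] by simp_all

  define F where "F k x = Re (salagean_q_harmonic q k h' g' (of_real x))" for k x
  \<comment> \<open>The sign combines \<open>(-1) ^ k\<close> from the operator on the conjugate
    part with \<open>(-1) ^ m\<close> from the form of \<open>g\<close>. It is 1 for
    \<open>k = m\<close> and -1 for \<open>k = m + 1\<close>.\<close>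
  have F: "(\<lambda>n. qint q n ^ k * (A n + (-1) ^ (k + m) * B n) * x ^ n) sums F k x"
    "salagean_q_harmonic q k h' g' (of_real x) = of_real (F k x)"
    if x: "0 < x" "x < 1" for x k
  proof -
    have "of_real x \<in> ball (0::complex) 1"
      using x by simp
    note * = salagean_q_sums[OF q h' this, of k] salagean_q_sums[OF q g' this, of k]
    have "(\<lambda>n. of_real (qint q n ^ k * (A n + (-1) ^ (k + m) * B n)) * of_real x ^ n) sums
        salagean_q_harmonic q k h' g' (of_real x)"
      unfolding salagean_q_harmonic_def
      using sums_add[OF *(1) sums_mult[OF iffD2[OF sums_cnj *(2)], of "(-1) ^ k"]]
      by (simp add: power_add distrib_left distrib_right ac_simps)
    from sums_of_real_coeffs[OF this]
    show "(\<lambda>n. qint q n ^ k * (A n + (-1) ^ (k + m) * B n) * x ^ n) sums F k x"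
      "salagean_q_harmonic q k h' g' (of_real x) = of_real (F k x)"
      by (simp_all add: F_def)
  qed
  have nz: "F m x \<noteq> 0" and ge: "F (m + 1) x / F m x \<ge> \<alpha>" if "0 < x" "x < 1" for x
    using quot[of "of_real x"] that F(2)[OF that] by (auto simp flip: of_real_divide)
  have Fm: "(\<lambda>n. qint q n ^ m * (A n + B n) * x ^ n) sums F m x" if "0 < x" "x < 1" for x
    using F(1)[OF that, of m] by (simp flip: mult_2)
  have Fm1: "(\<lambda>n. qint q n ^ Suc m * (A n - B n) * x ^ n) sums F (m + 1) x" if "0 < x" "x < 1" for x
    using F(1)[OF that, of "m + 1"] by (simp flip: mult_2)
  have pos: "F m x > 0" if "0 < x" "x < 1" for x
    by (rule powser_pos_if_nonzero[OF Fm nz _ _ that])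
      (use bb[of 1] q in \<open>auto simp: A_def B_def qint_1\<close>)

  define t where "t n = qint q n ^ m * ((qint q n - \<alpha>) * a n + (qint q n + \<alpha>) * b n)" for n
  define C where "C = 1 - \<alpha> - (1 + \<alpha>) * b 1"
  \<comment> \<open>In \<open>F (m + 1) x - \<alpha> * F m x\<close> the coefficient of
    \<open>x\<close> is \<open>C\<close>, and that of \<open>x ^ n\<close> for
    \<open>n \<ge> 2\<close> is \<open>- t n\<close>. This difference is nonnegative because
    \<open>F m x > 0\<close> lets the quotient condition be cleared of its denominator.\<close>
  have t_sums: "(\<lambda>n. t (n + 2) * x ^ (n + 2)) sums (C * x - (F (m + 1) x - \<alpha> * F m x))"
    if x: "0 < x" "x < 1" for x
  proof -
    have "(\<lambda>n. qint q n ^ Suc m * (A n - B n) * x ^ n - \<alpha> * (qint q n ^ m * (A n + B n) * x ^ n))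
        sums (F (m + 1) x - \<alpha> * F m x)"
      by (intro sums_diff sums_mult Fm Fm1 x)
    from sums_minus[OF iffD2[OF sums_iff_shift'[of _ 2] this]] show ?thesis
      using q by (simp add: numeral_2_eq_2 A_def B_def qint_1 t_def C_def algebra_simps)
  qed
  have t_bound: "(\<Sum>n. t (n + 2) * x ^ (n + 2)) \<le> C * x" if x: "0 < x" "x < 1" for x
    using t_sums[OF x] ge[OF x] pos[OF x] by (simp add: sums_iff field_simps)
  have t_nonneg: "t n \<ge> 0" if n: "n \<ge> 2" for n
  proof -
    have "qint q n \<ge> 1 + q"
      using qint_mono[of q 2 n] qint_2[of q] q n by simp
    then show ?thesis
      unfolding t_def using ab[of n] bb[of n] \<alpha> q n
      by (intro mult_nonneg_nonneg add_nonneg_nonneg zero_le_power) auto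
  qed
  \<comment> \<open>Padding with zeros aligns index and exponent, and replaces \<open>t 0\<close>
    and \<open>t 1\<close>, whose signs are not controlled by \<open>t_nonneg\<close>.\<close>
  define u where "u n = (if n < 2 then 0 else t n)" for n
  have u: "(\<lambda>n. u n * x ^ n) sums (\<Sum>n. t (n + 2) * x ^ (n + 2))" if "0 < x" "x < 1" for x
    by (subst sums_iff_shift'[of _ 2, symmetric])
      (use t_sums[OF that] in \<open>simp add: u_def sums_iff numeral_2_eq_2\<close>)
  have "sum u {..<N + 2} \<le> C"
    by (rule sum_coeffs_le_of_powser_le)
      (use u t_bound t_nonneg in \<open>auto simp: sums_iff u_def\<close>)
  also have "sum u {..<N + 2} = (\<Sum>n<N. t (n + 2))"
    by (induction N) (simp_all add: u_def numeral_2_eq_2)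
  finally show ?thesis
    by (simp add: t_def C_def)
qed

section \<open>The growth estimate\<close>

theorem theorem5:
  fixes q \<alpha> r :: real and m :: nat and f h g :: "complex \<Rightarrow> complex"
    and a b :: "nat \<Rightarrow> real" and z :: complex
  assumes "0 < q" and "q < 1"
    and "0 \<le> \<alpha>" and "\<alpha> < 1"
    and "f \<in> neg_harmonic_class q m \<alpha>"
    and "negative_coeff_form m f h g a b"
    and "norm z = r" and "r < 1"
  shows "(1 - b 1) * r
           - 1 / qint q 2 ^ m * ((1 - \<alpha>) / (qint q 2 - \<alpha>) - (1 + \<alpha>) / (qint q 2 - \<alpha>) * b 1) * r\<^sup>2
         \<le> norm (f z) \<and>
         norm (f z) \<le> (1 + b 1) * r
           + 1 / qint q 2 ^ m * ((1 - \<alpha>) / (qint q 2 - \<alpha>) - (1 + \<alpha>) / (qint q 2 - \<alpha>) * b 1) * r\<^sup>2"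
proof -
  note neg = \<open>negative_coeff_form m f h g a b\<close>
  define K where
    "K = 1 / qint q 2 ^ m * ((1 - \<alpha>) / (qint q 2 - \<alpha>) - (1 + \<alpha>) / (qint q 2 - \<alpha>) * b 1)"
  \<comment> \<open>\<open>P\<close> is the weight of \<open>a 2\<close> in the coefficient
    inequality and a lower bound for all weights there, since \<open>qint q\<close> is increasing
    and \<open>\<alpha> \<ge> 0\<close>. Dividing the inequality by \<open>P\<close> produces
    \<open>K\<close>.\<close>
  define P where "P = qint q 2 ^ m * (qint q 2 - \<alpha>)"
  have z: "z \<in> ball 0 1" and r: "0 \<le> r"
    using assms by auto
  have a: "a (n + 2) \<ge> 0" and b: "b (Suc n) \<ge> 0" for n
    using neg by (auto simp: negative_coeff_form_def)
  have q2: "qint q 2 = 1 + q"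
    using assms by (simp add: qint_2)
  have P: "P > 0"
    using assms by (simp add: P_def q2)
  have sum_le: "(\<Sum>n<N. a (n + 2) + b (n + 2)) \<le> K" for N
  proof -
    have "P * (\<Sum>n<N. a (n + 2) + b (n + 2)) \<le> (\<Sum>n<N. qint q (n + 2) ^ m *
      ((qint q (n + 2) - \<alpha>) * a (n + 2) + (qint q (n + 2) + \<alpha>) * b (n + 2)))"
      unfolding sum_distrib_left
    proof (rule sum_mono)
      fix n
      have le: "qint q 2 \<le> qint q (n + 2)"
        using assms by (intro qint_mono) auto
      have "P * (a (n + 2) + b (n + 2))
          = qint q 2 ^ m * ((qint q 2 - \<alpha>) * a (n + 2) + (qint q 2 - \<alpha>) * b (n + 2))"
        by (simp add: P_def algebra_simps)
      also have "\<dots> \<le> qint q (n + 2) ^ m *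
          ((qint q (n + 2) - \<alpha>) * a (n + 2) + (qint q (n + 2) + \<alpha>) * b (n + 2))"
        using le a[of n] b[of "Suc n"] assms q2
        by (intro mult_mono add_mono power_mono add_nonneg_nonneg mult_nonneg_nonneg zero_le_power) auto
      finally show "P * (a (n + 2) + b (n + 2)) \<le> qint q (n + 2) ^ m *
          ((qint q (n + 2) - \<alpha>) * a (n + 2) + (qint q (n + 2) + \<alpha>) * b (n + 2))" .
    qed
    also have "\<dots> \<le> 1 - \<alpha> - (1 + \<alpha>) * b 1"
      using neg_harmonic_class_coeff_bound assms by blast
    also have "\<dots> = P * K"
    proof -
      have "qint q 2 ^ m > 0" "qint q 2 - \<alpha> > 0"
        using assms by (simp_all add: q2)
      then have "K = (1 - \<alpha> - (1 + \<alpha>) * b 1) / P"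
        unfolding K_def P_def by (simp add: diff_divide_distrib mult.commute)
      then show ?thesis using P by simp
    qed
    finally show ?thesis
      using P by simp
  qed

  define c where "c n = a (n + 2) + b (n + 2)" for n
  have c: "c n \<ge> 0" for n
    using a[of n] b[of "Suc n"] by (simp add: c_def)
  have csum: "summable c"
  proof (rule bounded_imp_summable)
    show "sum c {..n} \<le> K" for n
      using sum_le[of "Suc n"] by (simp add: c_def lessThan_Suc_atMost)
  qed (rule c)
  have ck: "suminf c \<le> K"
    using csum sum_le by (intro suminf_le_const) (auto simp: c_def)
  \<comment> \<open>\<open>\<beta>\<close> is the conjugated linear term of \<open>g\<close>, so
    \<open>E\<close> collects exactly the terms of degree at least 2.\<close>
  define \<beta> where "\<beta> = of_real ((-1) ^ m * b 1) * cnj z"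
  define E where "E = f z - z - \<beta>"
  define e where "e n =
    cnj (of_real ((-1) ^ m * b (n + 2)) * z ^ (n + 2)) - of_real (a (n + 2)) * z ^ (n + 2)" for n
  have "e sums E"
  proof -
    have g: "(\<lambda>n. of_real ((-1) ^ m * b (n + 2)) * z ^ (n + 2)) sums (g z - of_real ((-1) ^ m * b 1) * z)"
      using iffD2[OF sums_iff_shift'[of _ 2] negative_coeff_form_sums(2)[OF neg z]]
      by (simp add: numeral_2_eq_2)
    have h: "(\<lambda>n. of_real (a (n + 2)) * z ^ (n + 2)) sums (z - h z)"
      using sums_minus[OF iffD2[OF sums_iff_shift'[of _ 2] negative_coeff_form_sums(1)[OF neg z]]]
      by (simp add: numeral_2_eq_2)
    have "f z = h z + cnj (g z)"
      using neg z by (simp add: negative_coeff_form_def)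
    then have "E = cnj (g z - of_real ((-1) ^ m * b 1) * z) - (z - h z)"
      by (simp add: E_def \<beta>_def)
    then show ?thesis
      unfolding e_def using sums_diff[OF iffD2[OF sums_cnj g] h] by simp
  qed
  moreover have "norm (e n) \<le> c n * r\<^sup>2" for n
  proof -
    have "norm (e n) \<le> b (n + 2) * r ^ (n + 2) + a (n + 2) * r ^ (n + 2)"
      unfolding e_def using a[of n] b[of "Suc n"] assms(7)
      by (intro order.trans[OF norm_triangle_ineq4])
        (simp add: norm_mult norm_power abs_mult power_abs del: of_real_mult)
    also have "\<dots> = c n * r ^ (n + 2)"
      by (simp add: c_def algebra_simps)
    \<comment> \<open>Here \<open>r < 1\<close> lets one factor \<open>r\<^sup>2\<close> serve for
      every degree, so the tail is controlled by \<open>suminf c\<close>.\<close>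
    also have "\<dots> \<le> c n * r\<^sup>2"
      using r assms(8) c by (intro mult_left_mono power_decreasing) auto
    finally show ?thesis .
  qed
  ultimately have "norm E \<le> suminf c * r\<^sup>2"
    using norm_sums_le[of e E "\<lambda>n. c n * r\<^sup>2"] sums_mult2[OF summable_sums[OF csum]] by blast
  also have "\<dots> \<le> K * r\<^sup>2"
    using ck by (intro mult_right_mono) auto
  finally have E: "norm E \<le> K * r\<^sup>2" .
  have \<beta>: "norm \<beta> = b 1 * r"
    using b[of 0] assms(7) by (simp add: \<beta>_def norm_mult abs_mult power_abs del: of_real_mult)
  \<comment> \<open>Both bounds follow by viewing \<open>f z\<close> as a perturbation of
    \<open>z\<close>, which has norm \<open>r\<close>.\<close>
  have "f z = z + (\<beta> + E)"
    by (simp add: E_def)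
  then have "r - norm (\<beta> + E) \<le> norm (f z)" "norm (f z) \<le> r + norm (\<beta> + E)"
    using norm_diff_ineq[of z "\<beta> + E"] norm_triangle_ineq[of z "\<beta> + E"] assms(7) by simp_all
  moreover have "norm (\<beta> + E) \<le> b 1 * r + K * r\<^sup>2"
    using norm_triangle_ineq[of \<beta> E] \<beta> E by simp
  ultimately show ?thesis
    unfolding K_def[symmetric] by (simp add: algebra_simps)
qed

end
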